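(* Let $M=X^{*}\bowtie G$ be a left Rees monoid, given by a self-similar action of a group $G$ on the free monoid $X^*$. Then the Zappa-Szép product $X^{*}\bowtie G$ can be extended to a Zappa-Szép product $FG(X)\bowtie G$ respecting the actions if and only if $M$ is symmetric. Here "can be extended respecting the actions" means that there are maps $G\times FG(X)\to FG(X)$, $(g,x)\mapsto g\cdot x$, and $G\times FG(X)\to G$, $(g,x)\mapsto g|_x$, satisfying axioms (SS1)-(SS8) with elements of $X^*$ replaced by elements of $FG(X)$, whose restrictions to $X^*\subseteq FG(X)$ are the given maps.
   Context: A self-similar action of a group $G$ on the free monoid $X^*$ consists of maps $G\times X^*\to X^*$, $(g,x)\mapsto g\cdot x$ and $G\times X^*\to G$, $(g,x)\mapsto g|_x$ such that for all $g,h\in G$, $x,y\in X^*$: (SS1) $1\cdot x=x$; (SS2) $(gh)\cdot x=g\cdot(h\cdot x)$; (SS3) $g\cdot 1=1$; (SS4) $g\cdot(xy)=(g\cdot x)(g|_x\cdot y)$; (SS5) $g|_1=g$; (SS6) $g|_{xy}=(g|_x)|_y$; (SS7) $1|_x=1$; (SS8) $(gh)|_x=g|_{h\cdot x}\,h|_x$. The Zappa-Szép product $X^*\bowtie G$ is the monoid on $X^*\times G$ with multiplication $(x,g)(y,h)=(x(g\cdot y),\,g|_y h)$. Left Rees monoids are exactly, up to isomorphism, the monoids of this form with $X\neq\emptyset$. $FG(X)$ denotes the free group on $X$, and the Zappa-Szép product $FG(X)\bowtie G$ is defined from maps satisfying (SS1)-(SS8) over $FG(X)$ by the same multiplication formula.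 The left Rees monoid $M=X^*\bowtie G$ is symmetric if for every $x\in X$ the map $\rho_x:G\to G$, $\rho_x(g)=g|_x$, is a bijection. *)

theory Defs
  imports "HOL-Algebra.Group"
begin

definition free_monoid :: "'x set \<Rightarrow> 'x list monoid" where
  "free_monoid X = \<lparr>carrier = lists X, mult = (@), one = []\<rparr>"

text \<open>
  The free group on \<open>X\<close> consists of the reduced words over \<open>X\<close> and formal inverses: the letter
  \<open>(False, x)\<close> stands for \<open>x\<close> and \<open>(True, x)\<close> for the inverse of \<open>x\<close>. The product of two reduced
  words is their concatenation followed by free reduction, which amounts to prepending the letters
  of the left factor one by one and cancelling where possible.
\<close>

type_synonym 'x letter = "bool \<times> 'x"

definition inv_letter :: "'x letter \<Rightarrow> 'x letter" where
  "inv_letter a = (\<not> fst a, snd a)"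

fun reduced :: "'x letter list \<Rightarrow> bool" where
  "reduced (a # b # w) \<longleftrightarrow> b \<noteq> inv_letter a \<and> reduced (b # w)"
| "reduced _ \<longleftrightarrow> True"

fun prepend :: "'x letter \<Rightarrow> 'x letter list \<Rightarrow> 'x letter list" where
  "prepend a [] = [a]"
| "prepend a (b # w) = (if b = inv_letter a then w else a # b # w)"

definition free_group :: "'x set \<Rightarrow> 'x letter list monoid" where
  "free_group X =
     \<lparr>carrier = {w \<in> lists (UNIV \<times> X). reduced w}, mult = foldr prepend, one = []\<rparr>"

definition word_embed :: "'x list \<Rightarrow> 'x letter list" where
  "word_embed w = map (Pair False) w"

lemma inv_letter_inv_letter [simp]: "inv_letter (inv_letter a) = a"
  by (simp add: inv_letter_def)

lemma inv_letter_neq [simp]: "inv_letter a \<noteq> a" "a \<noteq> inv_letter a"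
  by (auto simp: inv_letter_def prod_eq_iff)

lemma reduced_tl: "reduced (a # w) \<Longrightarrow> reduced w"
  by (cases w) auto

lemma reduced_prepend: "reduced w \<Longrightarrow> reduced (prepend a w)"
  by (cases w) (auto dest: reduced_tl)

lemma reduced_foldr_prepend: "reduced v \<Longrightarrow> reduced (foldr prepend u v)"
  by (induction u) (auto intro: reduced_prepend)

lemma prepend_inv_letter: "reduced w \<Longrightarrow> prepend a (prepend (inv_letter a) w) = w"
proof (induction w)
  case (Cons b w)
  then show ?case by (cases w) auto
qed simp

lemma foldr_prepend_assoc:
  assumes "reduced w"
  shows "foldr prepend (foldr prepend u v) w = foldr prepend u (foldr prepend v w)"
proof (induction u)
  case (Cons a u)
  have *: "foldr prepend (prepend a v') w = prepend a (foldr prepend v' w)" for v'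
    using prepend_inv_letter[OF reduced_foldr_prepend[OF assms]]
    by (cases v') auto
  show ?case using Cons by (simp add: *)
qed simp

lemma foldr_prepend_Nil: "reduced u \<Longrightarrow> foldr prepend u [] = u"
proof (induction u)
  case (Cons a u)
  then show ?case by (cases u) auto
qed simp

lemma lists_prepend: "a \<in> UNIV \<times> X \<Longrightarrow> w \<in> lists (UNIV \<times> X) \<Longrightarrow> prepend a w \<in> lists (UNIV \<times> X)"
  by (cases w) auto

lemma lists_foldr_prepend:
  "u \<in> lists (UNIV \<times> X) \<Longrightarrow> v \<in> lists (UNIV \<times> X) \<Longrightarrow> foldr prepend u v \<in> lists (UNIV \<times> X)"
proof (induction u)
  case (Cons a u)
  then have "foldr prepend u v \<in> lists (UNIV \<times> X)" "a \<in> UNIV \<times> X" by simp_all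
  then show ?case using lists_prepend[of a X] by simp
qed simp

lemma free_monoid_monoid: "monoid (free_monoid X)"
  by unfold_locales (auto simp: free_monoid_def)

lemma free_group_left_inverse:
  "w \<in> lists (UNIV \<times> X) \<Longrightarrow>
     \<exists>v \<in> carrier (free_group X). \<forall>u. reduced u \<longrightarrow> foldr prepend v (foldr prepend w u) = u"
proof (induction w)
  case Nil
  then show ?case by (intro bexI[of _ "[]"]) (auto simp: free_group_def)
next
  case (Cons a w)
  then obtain v where v: "v \<in> lists (UNIV \<times> X)" "reduced v"
      "\<And>u. reduced u \<Longrightarrow> foldr prepend v (foldr prepend w u) = u"
    by (auto simp: free_group_def)
  have a: "[inv_letter a] \<in> lists (UNIV \<times> X)"
    using Cons.prems by (auto simp: inv_letter_def)
  let ?v = "foldr prepend v [inv_letter a]"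
  have c: "prepend (inv_letter a) (prepend a y) = y" if "reduced y" for y
    using prepend_inv_letter[OF that, of "inv_letter a"] by simp
  have "?v \<in> carrier (free_group X)"
    using lists_foldr_prepend[OF v(1) a] by (simp add: free_group_def reduced_foldr_prepend)
  moreover have "foldr prepend ?v (foldr prepend (a # w) u) = u" if "reduced u" for u
    using that v(3)[OF that]
    by (simp add: foldr_prepend_assoc reduced_foldr_prepend reduced_prepend c)
  ultimately show ?case by blast
qed

lemma free_group_group: "group (free_group X)"
proof (rule groupI)
  fix x assume x: "x \<in> carrier (free_group X)"
  then have "x \<in> lists (UNIV \<times> X)" "reduced x" by (auto simp: free_group_def)
  with free_group_left_inverse obtain v where v: "v \<in> carrier (free_group X)"
      "\<forall>u. reduced u \<longrightarrow> foldr prepend v (foldr prepend x u) = u" by metis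
  from v(2) have "foldr prepend v (foldr prepend x []) = []" by simp
  then show "\<exists>y\<in>carrier (free_group X). y \<otimes>\<^bsub>free_group X\<^esub> x = \<one>\<^bsub>free_group X\<^esub>"
    using v(1) \<open>reduced x\<close> by (intro bexI[of _ v]) (simp_all add: free_group_def foldr_prepend_Nil)
next
  fix x y assume "x \<in> carrier (free_group X)" "y \<in> carrier (free_group X)"
  then show "x \<otimes>\<^bsub>free_group X\<^esub> y \<in> carrier (free_group X)"
    using lists_foldr_prepend[of x X y] by (simp add: free_group_def reduced_foldr_prepend)
qed (simp_all add: free_group_def foldr_prepend_assoc)

lemma reduced_word_embed: "reduced (word_embed w)"
  by (induction w rule: induct_list012) (auto simp: word_embed_def inv_letter_def)

lemma word_embed_hom: "word_embed \<in> hom (free_monoid X) (free_group X)"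
proof -
  have "foldr prepend (word_embed u) (word_embed v) = word_embed (u @ v)" for u v :: "'a list"
  proof (induction u)
    case (Cons x u)
    have "prepend (False, x) (word_embed (u @ v)) = word_embed ((x # u) @ v)"
      by (cases "u @ v") (auto simp: word_embed_def inv_letter_def)
    with Cons show ?case by (simp add: word_embed_def)
  qed (simp add: word_embed_def)
  moreover have "word_embed w \<in> lists (UNIV \<times> X)" if "w \<in> lists X" for w
    using that by (auto simp: word_embed_def)
  ultimately show ?thesis
    using reduced_word_embed
    by (intro homI) (simp_all add: free_monoid_def free_group_def del: in_lists_conv_set)
qed

lemma inj_word_embed: "inj word_embed"
  by (auto simp: inj_def word_embed_def dest: map_injective intro: injI)

text \<open>Universal property: every map from \<open>X\<close> into a group extends to a homomorphism on
  \<open>free_group X\<close>, and the generators determine this homomorphism.\<close>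

definition letter_value :: "('b, 'm) monoid_scheme \<Rightarrow> ('x \<Rightarrow> 'b) \<Rightarrow> 'x letter \<Rightarrow> 'b" where
  "letter_value H f a = (if fst a then inv\<^bsub>H\<^esub> f (snd a) else f (snd a))"

definition word_value :: "('b, 'm) monoid_scheme \<Rightarrow> ('x \<Rightarrow> 'b) \<Rightarrow> 'x letter list \<Rightarrow> 'b" where
  "word_value H f w = foldr (\<lambda>a y. letter_value H f a \<otimes>\<^bsub>H\<^esub> y) w \<one>\<^bsub>H\<^esub>"

lemma free_group_universal:
  assumes "group H" and f: "f \<in> X \<rightarrow> carrier H"
  shows "word_value H f \<in> hom (free_group X) H"
    and "\<forall>x\<in>X. word_value H f (word_embed [x]) = f x"
    and "\<And>\<phi> w. \<phi> \<in> hom (free_group X) H \<Longrightarrow> \<forall>x\<in>X. \<phi> (word_embed [x]) = f x \<Longrightarrow>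
           w \<in> carrier (free_group X) \<Longrightarrow> \<phi> w = word_value H f w"
proof -
  interpret H: group H by fact
  interpret F: group "free_group X" by (rule free_group_group)
  let ?v = "letter_value H f" and ?V = "word_value H f"
  have v: "?v a \<in> carrier H" if "a \<in> UNIV \<times> X" for a
    using that f by (auto simp: letter_value_def)
  have vi: "?v a \<otimes>\<^bsub>H\<^esub> ?v (inv_letter a) = \<one>\<^bsub>H\<^esub>" if "a \<in> UNIV \<times> X" for a
  proof -
    have "f (snd a) \<in> carrier H" using that f by auto
    then show ?thesis by (simp add: letter_value_def inv_letter_def)
  qed
  have V0 [simp]: "?V [] = \<one>\<^bsub>H\<^esub>" and VC [simp]: "?V (a # w) = ?v a \<otimes>\<^bsub>H\<^esub> ?V w" for a w
    by (simp_all add: word_value_def)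
  have V: "?V w \<in> carrier H" if "w \<in> lists (UNIV \<times> X)" for w
    using that
  proof (induction w)
    case (Cons a w)
    then show ?case using v[of a] by simp
  qed simp
  have pre: "?V (prepend a w) = ?v a \<otimes>\<^bsub>H\<^esub> ?V w"
    if "a \<in> UNIV \<times> X" "w \<in> lists (UNIV \<times> X)" for a w
  proof (cases w)
    case (Cons b w')
    then have b: "?v b \<in> carrier H" "?V w' \<in> carrier H" using that(2) v[of b] V[of w'] by simp_all
    show ?thesis
      using Cons b vi[OF that(1)] v[OF that(1)]
      by (auto simp: H.m_assoc[symmetric])
  qed simp
  have hom: "?V (foldr prepend u w) = ?V u \<otimes>\<^bsub>H\<^esub> ?V w"
    if "w \<in> lists (UNIV \<times> X)" "u \<in> lists (UNIV \<times> X)" for u w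
    using that(2)
  proof (induction u)
    case Nil
    then show ?case using V[OF that(1)] by simp
  next
    case (Cons a u)
    then have a: "a \<in> UNIV \<times> X" and u: "u \<in> lists (UNIV \<times> X)" by simp_all
    show ?case
      using pre[OF a lists_foldr_prepend[OF u that(1)]] Cons.IH v[OF a] V[OF u] V[OF that(1)]
      by (simp add: H.m_assoc)
  qed
  show "?V \<in> hom (free_group X) H"
  proof (rule homI)
    fix x assume "x \<in> carrier (free_group X)"
    then show "?V x \<in> carrier H" using V[of x] by (simp add: free_group_def)
  next
    fix x y assume "x \<in> carrier (free_group X)" "y \<in> carrier (free_group X)"
    then show "?V (x \<otimes>\<^bsub>free_group X\<^esub> y) = ?V x \<otimes>\<^bsub>H\<^esub> ?V y"
      using hom[of y x] by (simp add: free_group_def)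
  qed
  show "\<forall>x\<in>X. ?V (word_embed [x]) = f x"
    using f by (auto simp: word_embed_def letter_value_def intro!: H.r_one)
  fix \<phi> w assume \<phi>: "\<phi> \<in> hom (free_group X) H" and gen: "\<forall>x\<in>X. \<phi> (word_embed [x]) = f x"
    and w: "w \<in> carrier (free_group X)"
  interpret \<phi>: group_hom "free_group X" H \<phi>
    using \<phi> by unfold_locales
  have lt: "[a] \<in> carrier (free_group X)" if "a \<in> UNIV \<times> X" for a
    using that by (auto simp: free_group_def)
  have \<phi>v: "\<phi> [a] = ?v a" if a: "a \<in> UNIV \<times> X" for a
  proof (cases a)
    case (Pair s x)
    then have x: "x \<in> X" using a by simp
    have c: "[(s', x)] \<in> carrier (free_group X)" for s' using lt x by simp
    have "[(True, x)] \<otimes>\<^bsub>free_group X\<^esub> [(False, x)] = \<one>\<^bsub>free_group X\<^esub>"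
      by (simp add: free_group_def inv_letter_def)
    then have "[(True, x)] = inv\<^bsub>free_group X\<^esub> [(False, x)]"
      using F.inv_equality[OF _ c c] by simp
    then have "\<phi> [(True, x)] = inv\<^bsub>H\<^esub> (f x)" "\<phi> [(False, x)] = f x"
      using gen x \<phi>.hom_inv[OF c] by (simp_all add: word_embed_def)
    then show ?thesis using Pair by (simp add: letter_value_def)
  qed
  show "\<phi> w = ?V w" using w
  proof (induction w)
    case Nil
    then show ?case using \<phi>.hom_one by (simp add: free_group_def)
  next
    case (Cons a w)
    then have a: "a \<in> UNIV \<times> X" and w: "w \<in> carrier (free_group X)"
      by (auto simp: free_group_def dest: reduced_tl)
    have "a # w = [a] \<otimes>\<^bsub>free_group X\<^esub> w"
      using Cons.prems by (cases w) (auto simp: free_group_def)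
    then have "\<phi> (a # w) = ?v a \<otimes>\<^bsub>H\<^esub> ?V w"
      using Cons.IH[OF w] \<phi>.hom_mult[OF lt[OF a] w] \<phi>v[OF a] by simp
    then show ?case by simp
  qed
qed

text \<open>
  The axioms (SS1)--(SS8) over an arbitrary monoid \<open>M\<close>; \<open>act g x\<close> is \<open>g \<cdot> x\<close> and \<open>res g x\<close> is
  the restriction of \<open>g\<close> to \<open>x\<close>. The values of \<open>act\<close> and \<open>res\<close> outside the carriers are irrelevant.
\<close>

locale self_similar_action = group G + M: monoid M
  for G :: "('g, 'm) monoid_scheme" (structure) and M :: "('a, 'n) monoid_scheme"
    and act :: "'g \<Rightarrow> 'a \<Rightarrow> 'a" and res :: "'g \<Rightarrow> 'a \<Rightarrow> 'g" +
  assumes act_closed: "g \<in> carrier G \<Longrightarrow> x \<in> carrier M \<Longrightarrow> act g x \<in> carrier M"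
    and res_closed: "g \<in> carrier G \<Longrightarrow> x \<in> carrier M \<Longrightarrow> res g x \<in> carrier G"
    and SS1: "x \<in> carrier M \<Longrightarrow> act \<one> x = x"
    and SS2: "g \<in> carrier G \<Longrightarrow> h \<in> carrier G \<Longrightarrow> x \<in> carrier M \<Longrightarrow>
                act (g \<otimes> h) x = act g (act h x)"
    and SS3: "g \<in> carrier G \<Longrightarrow> act g \<one>\<^bsub>M\<^esub> = \<one>\<^bsub>M\<^esub>"
    and SS4: "g \<in> carrier G \<Longrightarrow> x \<in> carrier M \<Longrightarrow> y \<in> carrier M \<Longrightarrow>
                act g (x \<otimes>\<^bsub>M\<^esub> y) = act g x \<otimes>\<^bsub>M\<^esub> act (res g x) y"
    and SS5: "g \<in> carrier G \<Longrightarrow> res g \<one>\<^bsub>M\<^esub> = g"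
    and SS6: "g \<in> carrier G \<Longrightarrow> x \<in> carrier M \<Longrightarrow> y \<in> carrier M \<Longrightarrow>
                res g (x \<otimes>\<^bsub>M\<^esub> y) = res (res g x) y"
    and SS7: "x \<in> carrier M \<Longrightarrow> res \<one> x = \<one>"
    and SS8: "g \<in> carrier G \<Longrightarrow> h \<in> carrier G \<Longrightarrow> x \<in> carrier M \<Longrightarrow>
                res (g \<otimes> h) x = res g (act h x) \<otimes> res h x"

definition zappa_szep ::
  "('a, 'n) monoid_scheme \<Rightarrow> ('g, 'm) monoid_scheme \<Rightarrow> ('g \<Rightarrow> 'a \<Rightarrow> 'a) \<Rightarrow> ('g \<Rightarrow> 'a \<Rightarrow> 'g) \<Rightarrow>
     ('a \<times> 'g) monoid" where
  "zappa_szep M G act res =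
     \<lparr>carrier = carrier M \<times> carrier G,
      mult = (\<lambda>(x, g) (y, h). (x \<otimes>\<^bsub>M\<^esub> act g y, res g y \<otimes>\<^bsub>G\<^esub> h)),
      one = (\<one>\<^bsub>M\<^esub>, \<one>\<^bsub>G\<^esub>)\<rparr>"

lemma (in self_similar_action) monoid_zappa_szep: "monoid (zappa_szep M G act res)"
  by (rule monoidI)
    (auto simp: zappa_szep_def act_closed res_closed SS1 SS2 SS3 SS4 SS5 SS6 SS7 SS8
       m_assoc M.m_assoc)

definition symmetric_action ::
  "('g, 'm) monoid_scheme \<Rightarrow> 'x set \<Rightarrow> ('g \<Rightarrow> 'x list \<Rightarrow> 'g) \<Rightarrow> bool" where
  "symmetric_action G X res \<longleftrightarrow> (\<forall>x\<in>X. bij_betw (\<lambda>g. res g [x]) (carrier G) (carrier G))"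

definition extends_to_free_group ::
  "('g, 'm) monoid_scheme \<Rightarrow> 'x set \<Rightarrow> ('g \<Rightarrow> 'x list \<Rightarrow> 'x list) \<Rightarrow> ('g \<Rightarrow> 'x list \<Rightarrow> 'g) \<Rightarrow> bool"
  where
  "extends_to_free_group G X act res \<longleftrightarrow>
     (\<exists>act' res'. self_similar_action G (free_group X) act' res' \<and>
        (\<forall>g\<in>carrier G. \<forall>w\<in>lists X.
           act' g (word_embed w) = word_embed (act g w) \<and> res' g (word_embed w) = res g w))"

text \<open>An extension makes the Zappa-Szep product over the free monoid a submonoid of the one over
  the free group.\<close>

lemma zappa_szep_embed_hom:
  assumes "self_similar_action G (free_monoid X) act res"
    and "\<forall>g\<in>carrier G. \<forall>w\<in>lists X.
           act' g (word_embed w) = word_embed (act g w) \<and> res' g (word_embed w) = res g w"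
  shows "map_prod word_embed id \<in>
           hom (zappa_szep (free_monoid X) G act res) (zappa_szep (free_group X) G act' res')"
proof -
  interpret self_similar_action G "free_monoid X" act res by fact
  have c: "carrier (free_monoid X) = lists X" by (simp add: free_monoid_def)
  have e: "word_embed w \<in> carrier (free_group X)" if "w \<in> lists X" for w
    using hom_in_carrier[OF word_embed_hom, of w X] that c by simp
  have m: "word_embed (u \<otimes>\<^bsub>free_monoid X\<^esub> v) = word_embed u \<otimes>\<^bsub>free_group X\<^esub> word_embed v"
    if "u \<in> lists X" "v \<in> lists X" for u v
    using hom_mult[OF word_embed_hom, of u X v] that c by simp
  have a: "act g w \<in> lists X" if "g \<in> carrier G" "w \<in> lists X" for g w
    using act_closed[of g w] that c by simp
  show ?thesis
  proof (rule homI)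
    fix p assume "p \<in> carrier (zappa_szep (free_monoid X) G act res)"
    then show "map_prod word_embed id p \<in> carrier (zappa_szep (free_group X) G act' res')"
      using e by (cases p) (simp add: zappa_szep_def c del: in_lists_conv_set)
  next
    fix p q
    assume "p \<in> carrier (zappa_szep (free_monoid X) G act res)"
      and "q \<in> carrier (zappa_szep (free_monoid X) G act res)"
    then obtain u g v h where "p = (u, g)" "q = (v, h)" "u \<in> lists X" "v \<in> lists X"
        "g \<in> carrier G" "h \<in> carrier G"
      by (auto simp: zappa_szep_def c simp del: in_lists_conv_set)
    then show "map_prod word_embed id (p \<otimes>\<^bsub>zappa_szep (free_monoid X) G act res\<^esub> q) =
        map_prod word_embed id p \<otimes>\<^bsub>zappa_szep (free_group X) G act' res'\<^esub> map_prod word_embed id q"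
      using m[OF _ a] assms(2) by (simp add: zappa_szep_def del: in_lists_conv_set)
  qed
qed

end

theory Submission
  imports Defs
begin

text \<open>
  Necessity is read off from cancellation: in \<open>FG(X)\<close> the words \<open>x x\<^sup>-\<^sup>1\<close> and \<open>x\<^sup>-\<^sup>1 x\<close> are trivial, so
  by (SS5) and (SS6) restricting to \<open>x\<^sup>-\<^sup>1\<close> is a two-sided inverse of \<open>\<rho>\<^sub>x\<close>.

  For sufficiency, the same computation dictates the extension. From \<open>g \<cdot> (x x\<^sup>-\<^sup>1) = 1\<close> one gets
  \<open>h|\<^bsub>x\<^sup>-\<^sup>1\<^esub> = \<rho>\<^sub>x\<^sup>-\<^sup>1(h)\<close> and \<open>h \<cdot> x\<^sup>-\<^sup>1 = (\<rho>\<^sub>x\<^sup>-\<^sup>1(h) \<cdot> x)\<^sup>-\<^sup>1\<close>. A self-similar action on a free monoid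
  preserves length (\<open>length_act\<close>), so \<open>\<rho>\<^sub>x\<^sup>-\<^sup>1(h) \<cdot> x\<close> is a letter and these formulas send letters to
  letters. One thus obtains an automaton whose states are the elements of \<open>G\<close>: in state \<open>g\<close> it reads
  a signed letter \<open>a\<close>, writes \<open>g \<cdot> a\<close> and passes to \<open>g|\<^sub>a\<close>. Running it along words defines the
  extension.

  What makes this well behaved on reduced words is that reading \<open>a\<close> and then \<open>a\<^sup>-\<^sup>1\<close> writes a letter
  and then its inverse and returns to the initial state; conversely, as each \<open>g\<close> permutes the signed
  letters, the output cancels only where the input does. Hence the automaton commutes with
  \<open>prepend\<close> (\<open>run_prepend\<close>), and (SS4) and (SS6) follow by induction along the left factor.
\<close>

section \<open>Self-similar actions on free monoids preserve length\<close>

lemma act_Cons: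
  assumes "self_similar_action G (free_monoid X) act res"
    and "g \<in> carrier G" "x \<in> X" "w \<in> lists X"
  shows "act g (x # w) = act g [x] @ act (res g [x]) w"
    and "res g (x # w) = res (res g [x]) w"
proof -
  interpret self_similar_action G "free_monoid X" act res by fact
  show "act g (x # w) = act g [x] @ act (res g [x]) w" "res g (x # w) = res (res g [x]) w"
    using SS4[of g "[x]" w] SS6[of g "[x]" w] assms(2-) by (simp_all add: free_monoid_def)
qed

text \<open>
  A nonempty word cannot be sent to the empty one, since \<open>g\<^sup>-\<^sup>1\<close> fixes the latter; so by (SS4) each
  letter contributes at least one letter to the image, and no group element shortens a word.
  Applied to \<open>g\<^sup>-\<^sup>1\<close> this shows that \<open>g\<close> does not lengthen words either.
\<close>

lemma length_act:
  assumes "self_similar_action G (free_monoid X) act res"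
    and "g \<in> carrier G" "w \<in> lists X"
  shows "length (act g w) = length w"
proof -
  interpret self_similar_action G "free_monoid X" act res by fact
  have c: "carrier (free_monoid X) = lists X" and e: "\<one>\<^bsub>free_monoid X\<^esub> = []"
    by (simp_all add: free_monoid_def)
  have inv_act: "act (inv\<^bsub>G\<^esub> h) (act h u) = u" if "h \<in> carrier G" "u \<in> lists X" for h u
    using SS2[of "inv\<^bsub>G\<^esub> h" h u] SS1[of u] that c by simp
  have le: "length u \<le> length (act h u)" if "h \<in> carrier G" "u \<in> lists X" for h u
    using that(2,1)
  proof (induction u arbitrary: h)
    case (Cons x u)
    have x: "[x] \<in> lists X" using Cons by simp
    have "res h [x] \<in> carrier G" using res_closed[of h "[x]"] Cons.prems x c by simp
    then have "length u \<le> length (act (res h [x]) u)" by (rule Cons.IH)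
    moreover have "act h [x] \<noteq> []"
      using inv_act[of h "[x]"] SS3[of "inv\<^bsub>G\<^esub> h"] Cons.prems x e by force
    ultimately show ?case
      using act_Cons(1)[OF assms(1) Cons.prems Cons.hyps] by (cases "act h [x]") auto
  qed simp
  have "act g w \<in> lists X" using act_closed[of g w] assms c by simp
  then show ?thesis
    using le[of g w] le[of "inv\<^bsub>G\<^esub> g" "act g w"] inv_act[of g w] assms by simp
qed

section \<open>Running an automaton along words over signed letters\<close>

primrec run_act :: "('g \<Rightarrow> 'a \<Rightarrow> 'a) \<Rightarrow> ('g \<Rightarrow> 'a \<Rightarrow> 'g) \<Rightarrow> 'g \<Rightarrow> 'a list \<Rightarrow> 'a list" where
  "run_act A R g [] = []"
| "run_act A R g (a # w) = A g a # run_act A R (R g a) w"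

primrec run_res :: "('g \<Rightarrow> 'a \<Rightarrow> 'g) \<Rightarrow> 'g \<Rightarrow> 'a list \<Rightarrow> 'g" where
  "run_res R g [] = g"
| "run_res R g (a # w) = run_res R (R g a) w"

text \<open>
  The conditions on the values \<open>A g a = g \<cdot> a\<close> and \<open>R g a = g|\<^sub>a\<close> at signed letters: the one-letter
  instances of (SS1), (SS2), (SS7), (SS8), and compatibility with the cancellation of \<open>a a\<^sup>-\<^sup>1\<close>.
\<close>

locale signed_letter_action = group G
  for G :: "('g, 'm) monoid_scheme" (structure) and X :: "'x set"
    and A :: "'g \<Rightarrow> 'x letter \<Rightarrow> 'x letter" and R :: "'g \<Rightarrow> 'x letter \<Rightarrow> 'g" +
  assumes A_closed: "g \<in> carrier G \<Longrightarrow> a \<in> UNIV \<times> X \<Longrightarrow> A g a \<in> UNIV \<times> X"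
    and R_closed: "g \<in> carrier G \<Longrightarrow> a \<in> UNIV \<times> X \<Longrightarrow> R g a \<in> carrier G"
    and A_one: "a \<in> UNIV \<times> X \<Longrightarrow> A \<one> a = a"
    and R_one: "a \<in> UNIV \<times> X \<Longrightarrow> R \<one> a = \<one>"
    and A_mult: "g \<in> carrier G \<Longrightarrow> h \<in> carrier G \<Longrightarrow> a \<in> UNIV \<times> X \<Longrightarrow> A (g \<otimes> h) a = A g (A h a)"
    and R_mult: "g \<in> carrier G \<Longrightarrow> h \<in> carrier G \<Longrightarrow> a \<in> UNIV \<times> X \<Longrightarrow>
                   R (g \<otimes> h) a = R g (A h a) \<otimes> R h a"
    and A_cancel: "g \<in> carrier G \<Longrightarrow> a \<in> UNIV \<times> X \<Longrightarrow> A (R g a) (inv_letter a) = inv_letter (A g a)"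
    and R_cancel: "g \<in> carrier G \<Longrightarrow> a \<in> UNIV \<times> X \<Longrightarrow> R (R g a) (inv_letter a) = g"
begin

lemma inv_letter_closed: "a \<in> UNIV \<times> X \<Longrightarrow> inv_letter a \<in> UNIV \<times> X"
  by (auto simp: inv_letter_def)

lemma A_inj:
  assumes "g \<in> carrier G" "a \<in> UNIV \<times> X" "b \<in> UNIV \<times> X" "A g a = A g b"
  shows "a = b"
  using A_mult[of "inv g" g a] A_mult[of "inv g" g b] A_one[of a] A_one[of b] assms by simp

text \<open>
  By injectivity of \<open>A (R g a)\<close>, the output letters cancel only if the input letters do.
\<close>

lemma A_eq_inv_letter_iff:
  assumes "g \<in> carrier G" "a \<in> UNIV \<times> X" "b \<in> UNIV \<times> X"
  shows "A (R g a) b = inv_letter (A g a) \<longleftrightarrow> b = inv_letter a"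
  using A_inj[of "R g a" b "inv_letter a"] A_cancel[of g a] R_closed[of g a]
    inv_letter_closed[of a] assms
  by auto

lemma run_closed:
  assumes "w \<in> lists (UNIV \<times> X)" "g \<in> carrier G"
  shows "run_act A R g w \<in> lists (UNIV \<times> X)" and "run_res R g w \<in> carrier G"
  using assms
proof (induction w arbitrary: g)
  case (Cons a w)
  { case 1 with Cons show ?case using A_closed[of g a] R_closed[of g a] by simp }
  { case 2 with Cons show ?case using R_closed[of g a] by simp }
qed simp_all

lemma run_one:
  assumes "w \<in> lists (UNIV \<times> X)"
  shows "run_act A R \<one> w = w" and "run_res R \<one> w = \<one>"
  using assms by (induction w) (auto simp: A_one R_one)

lemma run_mult:
  assumes "w \<in> lists (UNIV \<times> X)" "g \<in> carrier G" "h \<in> carrier G"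
  shows "run_act A R (g \<otimes> h) w = run_act A R g (run_act A R h w)"
    and "run_res R (g \<otimes> h) w = run_res R g (run_act A R h w) \<otimes> run_res R h w"
  using assms
proof (induction w arbitrary: g h)
  case (Cons a w)
  { case 1 with Cons show ?case
      using A_closed[of h a] R_closed[of h a] R_closed[of g "A h a"] by (simp add: A_mult R_mult) }
  { case 2 with Cons show ?case
      using A_closed[of h a] R_closed[of h a] R_closed[of g "A h a"] by (simp add: R_mult) }
qed simp_all

text \<open>
  If \<open>w\<close> begins with \<open>a\<^sup>-\<^sup>1\<close>, running on \<open>w\<close> from the state \<open>g|\<^sub>a\<close> first writes \<open>(g \<cdot> a)\<^sup>-\<^sup>1\<close> and returns
  to \<open>g\<close>, so both sides cancel; otherwise neither does.
\<close>

lemma run_prepend: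
  assumes "g \<in> carrier G" "a \<in> UNIV \<times> X" "w \<in> lists (UNIV \<times> X)"
  shows "run_act A R g (prepend a w) = prepend (A g a) (run_act A R (R g a) w)"
    and "run_res R g (prepend a w) = run_res R (R g a) w"
  using assms A_eq_inv_letter_iff[of g a] R_cancel[of g a]
  by (cases w; force)+

lemma reduced_run_act:
  assumes "g \<in> carrier G" "w \<in> lists (UNIV \<times> X)" "reduced w"
  shows "reduced (run_act A R g w)"
  using assms
proof (induction w arbitrary: g rule: reduced.induct)
  case (1 a b w)
  then show ?case
    using A_eq_inv_letter_iff[of g a b] R_closed[of g a] 1(1)[of "R g a"] by simp
qed simp_all

lemma run_foldr_prepend:
  assumes "u \<in> lists (UNIV \<times> X)" "v \<in> lists (UNIV \<times> X)" "g \<in> carrier G"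
  shows "run_act A R g (foldr prepend u v) =
           foldr prepend (run_act A R g u) (run_act A R (run_res R g u) v)"
    and "run_res R g (foldr prepend u v) = run_res R (run_res R g u) v"
  using assms
proof (induction u arbitrary: g)
  case (Cons a u)
  { case 1 with Cons show ?case
      using R_closed[of g a] run_prepend(1)[of g a "foldr prepend u v"] lists_foldr_prepend[of u X v]
      by simp }
  { case 2 with Cons show ?case
      using R_closed[of g a] run_prepend(2)[of g a "foldr prepend u v"] lists_foldr_prepend[of u X v]
      by simp }
qed simp_all

lemma self_similar_action_run: "self_similar_action G (free_group X) (run_act A R) (run_res R)"
proof -
  interpret F: group "free_group X" by (rule free_group_group)
  show ?thesis
    by unfold_locales
      (simp_all add: free_group_def run_closed run_one run_mult reduced_run_act run_foldr_prepend
        del: in_lists_conv_set)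
qed

end

section \<open>Extending a symmetric action\<close>

text \<open>
  At a negative letter \<open>x\<^sup>-\<^sup>1\<close> these are the values forced by cancellation, with \<open>\<rho>\<^sub>x\<^sup>-\<^sup>1\<close> rendered by
  \<open>inv_into\<close>; \<open>hd\<close> extracts the letter from the one-letter word \<open>g \<cdot> x\<close>.
\<close>

definition signed_res ::
  "('g, 'm) monoid_scheme \<Rightarrow> ('g \<Rightarrow> 'x list \<Rightarrow> 'g) \<Rightarrow> 'g \<Rightarrow> 'x letter \<Rightarrow> 'g" where
  "signed_res G res g a =
     (if fst a then inv_into (carrier G) (\<lambda>g. res g [snd a]) g else res g [snd a])"

definition signed_act ::
  "('g, 'm) monoid_scheme \<Rightarrow> ('g \<Rightarrow> 'x list \<Rightarrow> 'x list) \<Rightarrow> ('g \<Rightarrow> 'x list \<Rightarrow> 'g) \<Rightarrow>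
     'g \<Rightarrow> 'x letter \<Rightarrow> 'x letter" where
  "signed_act G act res g a =
     (fst a, hd (act (if fst a then signed_res G res g a else g) [snd a]))"

lemma signed_letter_action_signed:
  assumes "self_similar_action G (free_monoid X) act res" and "symmetric_action G X res"
  shows "signed_letter_action G X (signed_act G act res) (signed_res G res)"
proof -
  interpret self_similar_action G "free_monoid X" act res by fact
  define \<alpha> where "\<alpha> g x = hd (act g [x])" for g x
  define \<rho> where "\<rho> x g = res g [x]" for x g
  define \<sigma> where "\<sigma> x = inv_into (carrier G) (\<rho> x)" for x
  have c: "[x] \<in> carrier (free_monoid X)" if "x \<in> X" for x
    using that by (simp add: free_monoid_def)
  have act: "act g [x] = [\<alpha> g x]" if "g \<in> carrier G" "x \<in> X" for g x
    using length_act[OF assms(1), of g "[x]"] that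
    by (cases "act g [x]") (auto simp: \<alpha>_def)
  have \<alpha>_closed: "\<alpha> g x \<in> X" if "g \<in> carrier G" "x \<in> X" for g x
    using act_closed[OF that(1) c[OF that(2)]] act[OF that] by (simp add: free_monoid_def)
  have \<rho>_closed: "\<rho> x g \<in> carrier G" if "g \<in> carrier G" "x \<in> X" for g x
    using res_closed[OF that(1) c[OF that(2)]] by (simp add: \<rho>_def)
  have \<alpha>_one: "\<alpha> \<one>\<^bsub>G\<^esub> x = x" and \<rho>_one: "\<rho> x \<one>\<^bsub>G\<^esub> = \<one>\<^bsub>G\<^esub>" if "x \<in> X" for x
    using SS1[OF c[OF that]] SS7[OF c[OF that]] by (simp_all add: \<alpha>_def \<rho>_def)
  have \<alpha>_mult: "\<alpha> (g \<otimes>\<^bsub>G\<^esub> h) x = \<alpha> g (\<alpha> h x)"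
    and \<rho>_mult: "\<rho> x (g \<otimes>\<^bsub>G\<^esub> h) = \<rho> (\<alpha> h x) g \<otimes>\<^bsub>G\<^esub> \<rho> x h"
    if "g \<in> carrier G" "h \<in> carrier G" "x \<in> X" for g h x
    using SS2[OF that(1,2) c[OF that(3)]] SS8[OF that(1,2) c[OF that(3)]]
    by (simp_all add: act[OF that(2,3)] \<alpha>_def[of "g \<otimes>\<^bsub>G\<^esub> h"] \<alpha>_def[of g] \<rho>_def)
  have bij: "bij_betw (\<rho> x) (carrier G) (carrier G)" if "x \<in> X" for x
    using assms(2) that by (simp add: symmetric_action_def \<rho>_def[abs_def])
  have \<sigma>_closed: "\<sigma> x g \<in> carrier G" and \<rho>\<sigma>: "\<rho> x (\<sigma> x g) = g" and \<sigma>\<rho>: "\<sigma> x (\<rho> x g) = g"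
    if "g \<in> carrier G" "x \<in> X" for g x
    using bij[OF that(2)] that(1)
    by (simp_all add: \<sigma>_def bij_betw_def inv_into_into f_inv_into_f inv_into_f_f)
  have \<sigma>_eq: "\<sigma> x k = g" if "\<rho> x g = k" "g \<in> carrier G" "x \<in> X" for x g k
    using \<sigma>\<rho>[OF that(2,3)] that(1) by simp
  have \<sigma>_one: "\<sigma> x \<one>\<^bsub>G\<^esub> = \<one>\<^bsub>G\<^esub>" if "x \<in> X" for x
    using that by (intro \<sigma>_eq \<rho>_one) simp_all
  \<comment> \<open>(SS8) for inverse letters: apply \<open>\<rho>\<^sub>x\<close> to the right-hand side and use (SS8) for \<open>x\<close>.\<close>
  have \<sigma>_mult: "\<sigma> x (g \<otimes>\<^bsub>G\<^esub> h) = \<sigma> (\<alpha> (\<sigma> x h) x) g \<otimes>\<^bsub>G\<^esub> \<sigma> x h"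
    if "g \<in> carrier G" "h \<in> carrier G" "x \<in> X" for g h x
    using that by (intro \<sigma>_eq) (simp_all add: \<rho>_mult \<sigma>_closed \<alpha>_closed \<rho>\<sigma>)
  have R: "signed_res G res g (s, x) = (if s then \<sigma> x g else \<rho> x g)" for g s x
    by (simp add: signed_res_def \<sigma>_def \<rho>_def[abs_def])
  have A: "signed_act G act res g (s, x) = (s, \<alpha> (if s then \<sigma> x g else g) x)" for g s x
    by (simp add: signed_act_def R \<alpha>_def)
  show ?thesis
    by unfold_locales
      (auto simp: A R inv_letter_def \<alpha>_closed \<rho>_closed \<sigma>_closed \<alpha>_one \<rho>_one \<sigma>_one
        \<alpha>_mult \<rho>_mult \<sigma>_mult \<rho>\<sigma> \<sigma>\<rho>)
qed

lemma run_word_embed: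
  assumes "self_similar_action G (free_monoid X) act res"
    and "w \<in> lists X" "g \<in> carrier G"
  shows "run_act (signed_act G act res) (signed_res G res) g (word_embed w) = word_embed (act g w)"
    and "run_res (signed_res G res) g (word_embed w) = res g w"
proof -
  interpret self_similar_action G "free_monoid X" act res by fact
  have closed: "res h [x] \<in> carrier G" if "h \<in> carrier G" "x \<in> X" for h x
    using res_closed[of h "[x]"] that by (simp add: free_monoid_def)
  have hd: "act h [x] = [hd (act h [x])]" if "h \<in> carrier G" "x \<in> X" for h x
    using length_act[OF assms(1), of h "[x]"] that by (cases "act h [x]") auto
  have "run_act (signed_act G act res) (signed_res G res) g (word_embed w) = word_embed (act g w)
      \<and> run_res (signed_res G res) g (word_embed w) = res g w"
    using assms(2,3)
  proof (induction w arbitrary: g)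
    case Nil
    then show ?case
      using SS3[of g] SS5[of g] by (simp add: word_embed_def free_monoid_def)
  next
    case (Cons x w)
    have "act g (x # w) = hd (act g [x]) # act (res g [x]) w"
      using act_Cons(1)[OF assms(1) Cons.prems Cons.hyps] hd[OF Cons.prems Cons.hyps(1)]
      by (metis append_Cons append_Nil)
    then show ?case
      using act_Cons(2)[OF assms(1) Cons.prems Cons.hyps]
        Cons.IH[OF closed[OF Cons.prems Cons.hyps(1)]]
      by (simp add: word_embed_def signed_act_def signed_res_def)
  qed
  then show "run_act (signed_act G act res) (signed_res G res) g (word_embed w) = word_embed (act g w)"
    and "run_res (signed_res G res) g (word_embed w) = res g w" by simp_all
qed

section \<open>The equivalence\<close>

text \<open>Restriction to \<open>x\<^sup>-\<^sup>1\<close> inverts restriction to \<open>x\<close>, by (SS5) and (SS6).\<close>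

lemma bij_betw_res:
  assumes "self_similar_action G M act res" and "group M" and x: "x \<in> carrier M"
  shows "bij_betw (\<lambda>g. res g x) (carrier G) (carrier G)"
proof -
  interpret self_similar_action G M act res by fact
  interpret M: group M by fact
  show ?thesis
    using SS5 SS6[of _ x "inv\<^bsub>M\<^esub> x"] SS6[of _ "inv\<^bsub>M\<^esub> x" x] x
    by (intro bij_betwI[where g = "\<lambda>g. res g (inv\<^bsub>M\<^esub> x)"]) (auto simp: res_closed)
qed

theorem theorem2p4p1:
  fixes G :: "('g, 'm) monoid_scheme" and X :: "'x set"
    and act :: "'g \<Rightarrow> 'x list \<Rightarrow> 'x list" and res :: "'g \<Rightarrow> 'x list \<Rightarrow> 'g"
  assumes "X \<noteq> {}"
    and "self_similar_action G (free_monoid X) act res"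
  shows "extends_to_free_group G X act res \<longleftrightarrow> symmetric_action G X res"
proof
  assume "extends_to_free_group G X act res"
  then obtain act' res' where ext: "self_similar_action G (free_group X) act' res'"
    and agree: "\<And>g w. g \<in> carrier G \<Longrightarrow> w \<in> lists X \<Longrightarrow> res' g (word_embed w) = res g w"
    unfolding extends_to_free_group_def by blast
  show "symmetric_action G X res"
    unfolding symmetric_action_def
  proof
    fix x assume "x \<in> X"
    then have x: "[x] \<in> lists X" by simp
    then have "word_embed [x] \<in> carrier (free_group X)"
      using hom_in_carrier[OF word_embed_hom, of "[x]" X] by (simp add: free_monoid_def)
    from bij_betw_res[OF ext free_group_group this]
    show "bij_betw (\<lambda>g. res g [x]) (carrier G) (carrier G)"
      by (simp add: agree[OF _ x] cong: bij_betw_cong)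
  qed
next
  assume sym: "symmetric_action G X res"
  interpret signed_letter_action G X "signed_act G act res" "signed_res G res"
    using assms(2) sym by (rule signed_letter_action_signed)
  show "extends_to_free_group G X act res"
    unfolding extends_to_free_group_def
    using self_similar_action_run run_word_embed[OF assms(2)] by blast
qed

end
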